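(* Let $\alpha:I\to E^3$ be a Frenet curve in $E^3$ and let $\beta$ be a Bertrand-direction curve of $\alpha$. If $\alpha$ is a plane curve, then $\beta$ is a helix. Similarly, if $\beta$ is a plane curve, then $\alpha$ is a helix.
   Context: $I\subset\mathbb{R}$ is an open interval and curves are smooth. A unit speed curve $\alpha:I\to E^3$ is a Frenet curve if its curvature $\kappa=\|\alpha''\|$ is nowhere zero; then $T=\alpha'$, $N=\alpha''/\kappa$, $B=T\times N$, and $T'=\kappa N$, $N'=-\kappa T+\tau B$, $B'=-\tau N$, where $\tau$ is the torsion. For a unit vector field $X(s)=a(s)T(s)+b(s)N(s)+c(s)B(s)$ with $a,b,c$ smooth and $a^2+b^2+c^2=1$, an $X$-direction curve of $\alpha$ is a curve $\beta:I\to E^3$ with $\beta'(s)=X(s)$; the parameter $s$ is then also arc length for $\beta$, whose Frenet apparatus is $\{\overline T,\overline N,\overline B\},\overline\kappa,\overline\tau$. An $X$-direction curve $\beta$ of $\alpha$ (for some such $X$) is called a Bertrand-direction curve of $\alpha$ if $\beta$ is a Bertrand curve of $\alpha$ (and $\alpha$ a Bertrand partner curve of $\beta$), in the sense that $\beta$ is a Frenet curve with $\overline N=N$ at each common parameter value $s$. A Frenet curve is a (general) helix if the ratio of its torsion to its curvature is constant. *)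

theory Defs
  imports "HOL-Analysis.Analysis"
begin

abbreviation vderiv :: "(real \<Rightarrow> 'a::real_normed_vector) \<Rightarrow> real \<Rightarrow> 'a" where
  "vderiv f \<equiv> (\<lambda>t. vector_derivative f (at t))"

(* C-infinity on an open set. Derivatives are taken at points of the open set I, so they do not
   depend on the values of f outside I. *)
definition smooth_on :: "real set \<Rightarrow> (real \<Rightarrow> 'a::real_normed_vector) \<Rightarrow> bool" where
  "smooth_on I f \<longleftrightarrow> (\<forall>k. \<forall>t\<in>I. (vderiv ^^ k) f differentiable (at t))"

definition unit_speed :: "real set \<Rightarrow> (real \<Rightarrow> real^3) \<Rightarrow> bool" where
  "unit_speed I \<alpha> \<longleftrightarrow> (\<forall>s\<in>I. norm (vderiv \<alpha> s) = 1)"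

definition curvature :: "(real \<Rightarrow> real^3) \<Rightarrow> real \<Rightarrow> real" where
  "curvature \<alpha> s = norm (vderiv (vderiv \<alpha>) s)"

definition frenet_curve :: "real set \<Rightarrow> (real \<Rightarrow> real^3) \<Rightarrow> bool" where
  "frenet_curve I \<alpha> \<longleftrightarrow> smooth_on I \<alpha> \<and> unit_speed I \<alpha> \<and> (\<forall>s\<in>I. curvature \<alpha> s \<noteq> 0)"

definition tangent :: "(real \<Rightarrow> real^3) \<Rightarrow> real \<Rightarrow> real^3" where
  "tangent \<alpha> s = vderiv \<alpha> s"

definition normal :: "(real \<Rightarrow> real^3) \<Rightarrow> real \<Rightarrow> real^3" where
  "normal \<alpha> s = (1 / curvature \<alpha> s) *\<^sub>R vderiv (vderiv \<alpha>) s"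

definition binormal :: "(real \<Rightarrow> real^3) \<Rightarrow> real \<Rightarrow> real^3" where
  "binormal \<alpha> s = cross3 (tangent \<alpha> s) (normal \<alpha> s)"

(* The coefficient in B' = - torsion * N. *)
definition torsion :: "(real \<Rightarrow> real^3) \<Rightarrow> real \<Rightarrow> real" where
  "torsion \<alpha> s = - (vderiv (binormal \<alpha>) s \<bullet> normal \<alpha> s)"

definition unit_frame_field :: "real set \<Rightarrow> (real \<Rightarrow> real^3) \<Rightarrow> (real \<Rightarrow> real^3) \<Rightarrow> bool" where
  "unit_frame_field I \<alpha> X \<longleftrightarrow>
     (\<exists>a b c :: real \<Rightarrow> real. smooth_on I a \<and> smooth_on I b \<and> smooth_on I c \<and>
        (\<forall>s\<in>I. (a s)\<^sup>2 + (b s)\<^sup>2 + (c s)\<^sup>2 = 1 \<and>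
                X s = a s *\<^sub>R tangent \<alpha> s + b s *\<^sub>R normal \<alpha> s + c s *\<^sub>R binormal \<alpha> s))"

definition direction_curve ::
    "real set \<Rightarrow> (real \<Rightarrow> real^3) \<Rightarrow> (real \<Rightarrow> real^3) \<Rightarrow> (real \<Rightarrow> real^3) \<Rightarrow> bool" where
  "direction_curve I \<alpha> X \<beta> \<longleftrightarrow>
     unit_frame_field I \<alpha> X \<and> smooth_on I \<beta> \<and> (\<forall>s\<in>I. (\<beta> has_vector_derivative X s) (at s))"

(* Corresponding points are those with the same parameter value, and the principal normals are
   equal there (not merely parallel). *)
definition bertrand_curve :: "real set \<Rightarrow> (real \<Rightarrow> real^3) \<Rightarrow> (real \<Rightarrow> real^3) \<Rightarrow> bool" where
  "bertrand_curve I \<alpha> \<beta> \<longleftrightarrow>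
     frenet_curve I \<alpha> \<and> frenet_curve I \<beta> \<and> (\<forall>s\<in>I. normal \<beta> s = normal \<alpha> s)"

definition bertrand_direction_curve ::
    "real set \<Rightarrow> (real \<Rightarrow> real^3) \<Rightarrow> (real \<Rightarrow> real^3) \<Rightarrow> bool" where
  "bertrand_direction_curve I \<alpha> \<beta> \<longleftrightarrow> (\<exists>X. direction_curve I \<alpha> X \<beta>) \<and> bertrand_curve I \<alpha> \<beta>"

definition plane_curve :: "real set \<Rightarrow> (real \<Rightarrow> real^3) \<Rightarrow> bool" where
  "plane_curve I \<alpha> \<longleftrightarrow> (\<exists>P. affine P \<and> aff_dim P = 2 \<and> \<alpha> ` I \<subseteq> P)"

definition helix :: "real set \<Rightarrow> (real \<Rightarrow> real^3) \<Rightarrow> bool" where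
  "helix I \<alpha> \<longleftrightarrow> frenet_curve I \<alpha> \<and> (\<exists>r. \<forall>s\<in>I. torsion \<alpha> s / curvature \<alpha> s = r)"

end

theory Submission
  imports Defs
begin

text \<open>
  If a curve lies in a plane with normal vector \<open>n\<close>, then the direction space of the plane contains its
  acceleration, so the principal normals of a plane curve are all orthogonal to the fixed vector
  \<open>n\<close> (\<open>plane_curve_normal_orthogonal\<close>). This property passes to any curve with the same principal
  normals. By one half of Lancret's theorem, a Frenet curve whose principal normals are all
  orthogonal to a fixed nonzero vector is a helix (\<open>helix_if_normal_orthogonal_to_direction\<close>).
  Equality of principal normals is symmetric in \<open>\<alpha>\<close> and \<open>\<beta>\<close>, so the two claims are instances
  of the same argument.

  Lancret's half is read off from the Frenet equations. As \<open>T'\<close> and \<open>B'\<close> are multiples of \<open>N\<close>, the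
  components \<open>c = T \<bullet> n\<close> and \<open>d = B \<bullet> n\<close> are constant; differentiating \<open>N \<bullet> n = 0\<close> gives
  \<open>\<tau> d = \<kappa> c\<close>. If \<open>d\<close> were zero, then so would be \<open>c\<close>, and \<open>n\<close> would be orthogonal to the whole
  frame; hence \<open>\<tau> / \<kappa> = c / d\<close>.
\<close>

unbundle cross3_syntax

text \<open>
  All the relations between a frame and its derivative come from differentiating a constant inner
  product. A fixed vector is allowed as one of the two factors.
\<close>

lemma deriv_inner_const:
  fixes f g :: "real \<Rightarrow> 'a::real_inner"
  assumes "open I" and "s \<in> I"
    and f: "(f has_vector_derivative f') (at s)" and g: "(g has_vector_derivative g') (at s)"
    and const: "\<And>t. t \<in> I \<Longrightarrow> f t \<bullet> g t = c"
  shows "f' \<bullet> g s + f s \<bullet> g' = 0"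
proof -
  have "((\<lambda>t. f t \<bullet> g t) has_vector_derivative f s \<bullet> g' + f' \<bullet> g s) (at s)"
    by (rule bounded_bilinear.has_vector_derivative[OF bounded_bilinear_inner f g])
  moreover have "((\<lambda>t. f t \<bullet> g t) has_vector_derivative 0) (at s)"
    by (rule has_vector_derivative_transform_within_open[of "\<lambda>t. c" _ _ I])
      (use assms in auto)
  ultimately show ?thesis
    using vector_derivative_unique_at by fastforce
qed

text \<open>
  The difference of the two sides is orthogonal to \<open>T\<close> and \<open>N\<close>, hence parallel to \<open>T \<times> N\<close>; it is
  also orthogonal to \<open>T \<times> N\<close>, which is a unit vector, so it vanishes.
\<close>

lemma orthonormal_cross_expansion:
  fixes T N v :: "real^3"
  assumes "T \<bullet> T = 1" "N \<bullet> N = 1" "T \<bullet> N = 0"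
  shows "v = (v \<bullet> T) *\<^sub>R T + (v \<bullet> N) *\<^sub>R N + (v \<bullet> (T \<times> N)) *\<^sub>R (T \<times> N)"
proof -
  define B where "B = T \<times> N"
  have B: "B \<bullet> B = 1" "B \<bullet> T = 0" "B \<bullet> N = 0"
    using assms by (simp_all add: B_def dot_cross dot_cross_self inner_commute)
  define w where "w = v - ((v \<bullet> T) *\<^sub>R T + (v \<bullet> N) *\<^sub>R N + (v \<bullet> B) *\<^sub>R B)"
  have w: "w \<bullet> T = 0" "w \<bullet> N = 0" "w \<bullet> B = 0"
    using assms B
    by (simp_all add: w_def inner_diff_left inner_add_left inner_commute[of N T]
        inner_commute[of T B] inner_commute[of N B])
  have "w \<times> B = 0"
    using w by (simp add: B_def Lagrange)
  then have "w = 0"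
    using w B norm_and_cross_eq_0[of w B] by auto
  then show ?thesis
    by (simp add: w_def B_def)
qed

lemma frenet_frame_orthonormal:
  assumes "open I" "frenet_curve I \<beta>" "s \<in> I"
  shows "(tangent \<beta> has_vector_derivative curvature \<beta> s *\<^sub>R normal \<beta> s) (at s)"
    and "tangent \<beta> s \<bullet> tangent \<beta> s = 1" "normal \<beta> s \<bullet> normal \<beta> s = 1"
    and "tangent \<beta> s \<bullet> normal \<beta> s = 0"
proof -
  have \<kappa>: "curvature \<beta> s \<noteq> 0"
    using assms by (auto simp: frenet_curve_def)
  have "(vderiv ^^ 1) \<beta> differentiable (at s)"
    using assms unfolding frenet_curve_def smooth_on_def by blast
  then have "(vderiv \<beta> has_vector_derivative vderiv (vderiv \<beta>) s) (at s)"
    by (simp add: vector_derivative_works)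
  then show T': "(tangent \<beta> has_vector_derivative curvature \<beta> s *\<^sub>R normal \<beta> s) (at s)"
    using \<kappa> by (simp add: tangent_def[abs_def] normal_def)
  have unit: "tangent \<beta> t \<bullet> tangent \<beta> t = 1" if "t \<in> I" for t
    using assms that by (simp add: frenet_curve_def unit_speed_def tangent_def dot_square_norm)
  show "tangent \<beta> s \<bullet> tangent \<beta> s = 1"
    using unit assms by blast
  have "norm (normal \<beta> s) = 1"
    using \<kappa> by (simp add: normal_def curvature_def)
  then show "normal \<beta> s \<bullet> normal \<beta> s = 1"
    by (simp add: dot_square_norm)
  show "tangent \<beta> s \<bullet> normal \<beta> s = 0"
    using deriv_inner_const[OF assms(1,3) T' T' unit] \<kappa> by (simp add: inner_commute)
qed

lemma normal_differentiable:
  assumes "frenet_curve I \<beta>" "s \<in> I"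
  shows "normal \<beta> differentiable (at s)"
proof -
  have "(vderiv ^^ 2) \<beta> differentiable (at s)"
    using assms unfolding frenet_curve_def smooth_on_def by blast
  then have A: "vderiv (vderiv \<beta>) differentiable (at s)"
    by (simp add: numeral_2_eq_2)
  have \<kappa>: "curvature \<beta> s \<noteq> 0"
    using assms by (auto simp: frenet_curve_def)
  then have "(\<lambda>t. curvature \<beta> t) differentiable (at s)"
    unfolding curvature_def
    by (intro differentiable_compose[OF _ A, of norm] differentiable_norm_at) simp
  then show ?thesis
    unfolding normal_def[abs_def] using A \<kappa>
    by (intro differentiable_scaleR differentiable_divide differentiable_const)
qed

text \<open>
  The curvature is defined from \<open>T'\<close> and the torsion from \<open>B'\<close>, so \<open>N'\<close> has to be recovered from
  these two by differentiating \<open>N \<bullet> T = 0\<close> and \<open>N \<bullet> B = 0\<close>. For \<open>B'\<close>, the term \<open>T' \<times> N\<close> of the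
  product rule vanishes because \<open>T'\<close> is parallel to \<open>N\<close>; so \<open>B' = T \<times> N'\<close> is orthogonal to \<open>T\<close>, and
  it is orthogonal to the unit vector \<open>B\<close>, which leaves only the component along \<open>N\<close>.
\<close>

lemma frenet_equations:
  assumes "open I" "frenet_curve I \<beta>" "s \<in> I"
  shows "(normal \<beta> has_vector_derivative
           - curvature \<beta> s *\<^sub>R tangent \<beta> s + torsion \<beta> s *\<^sub>R binormal \<beta> s) (at s)"
    and "(binormal \<beta> has_vector_derivative - torsion \<beta> s *\<^sub>R normal \<beta> s) (at s)"
proof -
  note frame = frenet_frame_orthonormal[OF assms(1,2)]
  define N' where "N' = vderiv (normal \<beta>) s"
  define B' where "B' = vderiv (binormal \<beta>) s"
  have N: "(normal \<beta> has_vector_derivative N') (at s)"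
    using normal_differentiable[OF assms(2,3)] by (simp add: N'_def vector_derivative_works)
  have "(binormal \<beta> has_vector_derivative
          tangent \<beta> s \<times> N' + (curvature \<beta> s *\<^sub>R normal \<beta> s) \<times> normal \<beta> s) (at s)"
    unfolding binormal_def[abs_def]
    by (rule bounded_bilinear.has_vector_derivative[OF _ frame(1)[OF assms(3)] N])
      (simp add: bilinear_conv_bounded_bilinear[symmetric] bilinear_cross)
  then have B: "(binormal \<beta> has_vector_derivative tangent \<beta> s \<times> N') (at s)"
    by (simp add: cross_mult_left)
  then have B'_eq: "B' = tangent \<beta> s \<times> N'"
    by (simp add: B'_def vector_derivative_at)
  have unitB: "binormal \<beta> t \<bullet> binormal \<beta> t = 1" "normal \<beta> t \<bullet> binormal \<beta> t = 0" if "t \<in> I" for t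
    using frame(2-4)[OF that]
    by (simp_all add: binormal_def dot_cross dot_cross_self inner_commute)
  note const = deriv_inner_const[OF assms(1,3)]
  have "B' \<bullet> tangent \<beta> s = 0"
    by (simp add: B'_eq dot_cross_self)
  moreover have "B' \<bullet> binormal \<beta> s = 0"
    using const[OF B B unitB(1)] by (simp add: B'_eq inner_commute)
  moreover have "B' \<bullet> normal \<beta> s = - torsion \<beta> s"
    by (simp add: torsion_def B'_def)
  ultimately have "B' = - torsion \<beta> s *\<^sub>R normal \<beta> s"
    using orthonormal_cross_expansion[OF frame(2-4)[OF assms(3)], of B']
    by (simp add: binormal_def)
  then show "(binormal \<beta> has_vector_derivative - torsion \<beta> s *\<^sub>R normal \<beta> s) (at s)"
    using B B'_eq by simp
  have "N' \<bullet> normal \<beta> s = 0"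
    using const[OF N N frame(3)] by (simp add: inner_commute)
  moreover have "N' \<bullet> tangent \<beta> s = - curvature \<beta> s"
    using const[OF N frame(1)[OF assms(3)], of 0] frame(3,4) assms(3)
    by (simp add: inner_commute)
  moreover have "N' \<bullet> binormal \<beta> s = torsion \<beta> s"
    using const[OF N B unitB(2)] by (simp add: torsion_def B'_eq[unfolded B'_def] inner_commute)
  ultimately have "N' = - curvature \<beta> s *\<^sub>R tangent \<beta> s + torsion \<beta> s *\<^sub>R binormal \<beta> s"
    using orthonormal_cross_expansion[OF frame(2-4)[OF assms(3)], of N']
    by (simp add: binormal_def)
  then show "(normal \<beta> has_vector_derivative
           - curvature \<beta> s *\<^sub>R tangent \<beta> s + torsion \<beta> s *\<^sub>R binormal \<beta> s) (at s)"
    using N by simp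
qed

lemma inner_const_if_deriv_orthogonal:
  fixes f :: "real \<Rightarrow> 'a::real_inner"
  assumes "convex I"
    and "\<And>s. s \<in> I \<Longrightarrow> (f has_vector_derivative f' s) (at s)" "\<And>s. s \<in> I \<Longrightarrow> f' s \<bullet> n = 0"
  shows "\<exists>c. \<forall>s\<in>I. f s \<bullet> n = c"
proof -
  have "((\<lambda>t. f t \<bullet> n) has_derivative (\<lambda>h. 0)) (at s within I)" if "s \<in> I" for s
  proof -
    have "((\<lambda>t. f t \<bullet> n) has_vector_derivative f' s \<bullet> n) (at s)"
      by (rule bounded_linear.has_vector_derivative[OF bounded_linear_inner_left assms(2)[OF that]])
    then show ?thesis
      using assms(3)[OF that] by (auto simp: has_vector_derivative_def intro: has_derivative_at_withinI)
  qed
  from has_derivative_zero_constant[OF assms(1) this] show ?thesis by metis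
qed

text \<open>
  The fixed direction \<open>n\<close> has constant components \<open>c\<close> along \<open>T\<close> and \<open>d\<close> along \<open>B\<close>, and it stays
  orthogonal to \<open>N\<close> only if the rotation of \<open>N\<close> towards \<open>B\<close>, at rate \<open>\<tau>\<close>, balances its rotation
  towards \<open>-T\<close>, at rate \<open>\<kappa>\<close>.
\<close>

lemma helix_if_normal_orthogonal_to_direction:
  assumes "open I" "convex I" "frenet_curve I \<beta>"
    and "n \<noteq> 0" and Nn: "\<And>s. s \<in> I \<Longrightarrow> normal \<beta> s \<bullet> n = 0"
  shows "helix I \<beta>"
proof -
  note frame = frenet_frame_orthonormal[OF assms(1,3)]
  note fe = frenet_equations[OF assms(1,3)]
  obtain c where c: "\<forall>s\<in>I. tangent \<beta> s \<bullet> n = c"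
    using inner_const_if_deriv_orthogonal[OF assms(2) frame(1)] Nn by force
  obtain d where d: "\<forall>s\<in>I. binormal \<beta> s \<bullet> n = d"
    using inner_const_if_deriv_orthogonal[OF assms(2) fe(2)] Nn by force
  have "torsion \<beta> s / curvature \<beta> s = c / d" if s: "s \<in> I" for s
  proof -
    have \<kappa>: "curvature \<beta> s \<noteq> 0"
      using assms s by (auto simp: frenet_curve_def)
    have "(- curvature \<beta> s *\<^sub>R tangent \<beta> s + torsion \<beta> s *\<^sub>R binormal \<beta> s) \<bullet> n = 0"
      using deriv_inner_const[OF assms(1) s fe(1)[OF s] has_vector_derivative_const Nn] by simp
    then have eq: "torsion \<beta> s * d = curvature \<beta> s * c"
      using c d s by (simp add: inner_diff_left)
    have "d \<noteq> 0"
    proof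
      assume "d = 0"
      with eq \<kappa> have "c = 0" by simp
      with \<open>d = 0\<close> have "n = 0"
        using orthonormal_cross_expansion[OF frame(2-4)[OF s], of n] c d s Nn[OF s]
        by (simp add: binormal_def inner_commute)
      with \<open>n \<noteq> 0\<close> show False ..
    qed
    with eq \<kappa> show ?thesis by (simp add: field_simps)
  qed
  with assms(3) show ?thesis by (auto simp: helix_def)
qed

text \<open>
  Differentiating the equation \<open>\<alpha> \<bullet> n = b\<close> of the plane twice gives \<open>T \<bullet> n = 0\<close> and \<open>\<kappa> (N \<bullet> n) = 0\<close>.
\<close>

lemma plane_curve_normal_orthogonal:
  assumes "open I" "frenet_curve I \<alpha>" "plane_curve I \<alpha>"
  obtains n where "n \<noteq> 0" "\<And>s. s \<in> I \<Longrightarrow> normal \<alpha> s \<bullet> n = 0"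
proof -
  from assms(3) obtain P :: "(real^3) set" where "aff_dim P = 2" and P: "\<alpha> ` I \<subseteq> P"
    by (auto simp: plane_curve_def)
  then have "aff_dim P < DIM(real^3)"
    by simp
  then obtain n b where "n \<noteq> 0" and n: "P \<subseteq> {x. n \<bullet> x = b}"
    using aff_lowdim_subset_hyperplane by blast
  have \<alpha>n: "\<alpha> t \<bullet> n = b" if "t \<in> I" for t
    using P n that by (subst inner_commute) auto
  have Tn: "tangent \<alpha> t \<bullet> n = 0" if t: "t \<in> I" for t
  proof -
    have "(vderiv ^^ 0) \<alpha> differentiable (at t)"
      using assms t unfolding frenet_curve_def smooth_on_def by blast
    then have "(\<alpha> has_vector_derivative tangent \<alpha> t) (at t)"
      by (simp add: tangent_def vector_derivative_works)
    from deriv_inner_const[OF assms(1) t this has_vector_derivative_const \<alpha>n] show ?thesis by simp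
  qed
  have "normal \<alpha> s \<bullet> n = 0" if s: "s \<in> I" for s
    using deriv_inner_const[OF assms(1) s frenet_frame_orthonormal(1)[OF assms(1,2) s]
        has_vector_derivative_const Tn] assms(2) s
    by (auto simp: frenet_curve_def)
  with \<open>n \<noteq> 0\<close> that show ?thesis by blast
qed

theorem theorem5p8:
  fixes I :: "real set" and \<alpha> \<beta> :: "real \<Rightarrow> real^3"
  assumes "open I" and "is_interval I" and "I \<noteq> {}"
    and "frenet_curve I \<alpha>"
    and "bertrand_direction_curve I \<alpha> \<beta>"
  shows "(plane_curve I \<alpha> \<longrightarrow> helix I \<beta>) \<and> (plane_curve I \<beta> \<longrightarrow> helix I \<alpha>)"
proof -
  have "convex I"
    using \<open>is_interval I\<close> by (rule is_interval_convex)
  have \<beta>: "frenet_curve I \<beta>" and N: "\<And>s. s \<in> I \<Longrightarrow> normal \<beta> s = normal \<alpha> s"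
    using assms(5) by (auto simp: bertrand_direction_curve_def bertrand_curve_def)
  have "helix I \<beta>" if "plane_curve I \<alpha>"
    using plane_curve_normal_orthogonal[OF assms(1,4) that]
      helix_if_normal_orthogonal_to_direction[OF assms(1) \<open>convex I\<close> \<beta>] N by metis
  moreover have "helix I \<alpha>" if "plane_curve I \<beta>"
    using plane_curve_normal_orthogonal[OF assms(1) \<beta> that]
      helix_if_normal_orthogonal_to_direction[OF assms(1) \<open>convex I\<close> assms(4)] N by metis
  ultimately show ?thesis by blast
qed

end
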